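(* Let $U\subset\mathbb{R}^2_+$ be a smooth bounded domain of the upper half plane whose boundary $\partial U$ does not intersect the line $\{y=0\}$. Suppose that $U$ is convex, let $K=\overline{U}$ be its closure (a compact convex subset of $\mathbb{R}^2$), and let $A=(a_1,a_2)$ be an interior point of $U$. Then $K$ is homeomorphic to a (closed) disc of center $A$.
   Context: The upper half plane is $\mathbb{R}^2_+=\{(x,y)\in\mathbb{R}^2 : y>0\}$. Discs are Euclidean discs in $\mathbb{R}^2$. *)

theory Defs
  imports "HOL-Analysis.Analysis"
begin

text \<open>The plane is \<^typ>\<open>real \<times> real\<close>, whose library norm is the Euclidean one, so that
  \<^const>\<open>cball\<close> gives the closed Euclidean discs.\<close>

definition upper_half_plane :: "(real \<times> real) set" where
  "upper_half_plane = {(x, y). y > 0}"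

definition domain :: "(real \<times> real) set \<Rightarrow> bool" where
  "domain U \<longleftrightarrow> open U \<and> connected U \<and> U \<noteq> {}"

definition smooth_fun :: "(real \<Rightarrow> real) \<Rightarrow> bool" where
  "smooth_fun g \<longleftrightarrow> (\<forall>n x. (deriv ^^ n) g differentiable (at x))"

text \<open>Boundary of class \<open>C\<^sup>\<infinity>\<close>: near each boundary point, and after a linear isometry of
  the plane, the set is the region lying strictly above the graph of a smooth function.\<close>

definition smooth_boundary :: "(real \<times> real) set \<Rightarrow> bool" where
  "smooth_boundary U \<longleftrightarrow>
     (\<forall>p \<in> frontier U. \<exists>r>0. \<exists>T g.
        orthogonal_transformation T \<and> smooth_fun g \<and>
        (\<forall>q \<in> ball p r. q \<in> U \<longleftrightarrow> g (fst (T q)) < snd (T q)))"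

definition smooth_bounded_domain :: "(real \<times> real) set \<Rightarrow> bool" where
  "smooth_bounded_domain U \<longleftrightarrow> domain U \<and> bounded U \<and> smooth_boundary U"

end

theory Submission
  imports Defs
begin

text \<open>Each ray from an interior point of a compact convex body meets the boundary exactly
  once, so rescaling along rays carries the body onto a disc.
  \<open>homeomorphic_convex_compact\<close> packages this for any two such bodies in the
  plane.\<close>

theorem proposition3p1:
  fixes U K :: "(real \<times> real) set" and a1 a2 :: real
  assumes "smooth_bounded_domain U"
    and "U \<subseteq> upper_half_plane"
    and "frontier U \<inter> {(x, y). y = 0} = {}"
    and "convex U"
    and "K = closure U"
    and "(a1, a2) \<in> interior U"
  shows "\<exists>r>0. K homeomorphic cball (a1, a2) r"
proof -
  have "convex K" "compact K"
    using assms by (simp_all add: smooth_bounded_domain_def)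
  moreover have "interior K \<noteq> {}"
    using assms(5,6) interior_mono[OF closure_subset] by blast
  \<comment> \<open>The radius 1 is arbitrary: the disc only has to be compact and convex with
    nonempty interior.\<close>
  ultimately have "K homeomorphic cball (a1, a2) 1"
    by (intro homeomorphic_convex_compact) auto
  then show ?thesis
    using zero_less_one by blast
qed

end
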